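(* Let $n\ge 2$. The set of idempotents of the multiplicative semigroup $(A^+(B_n),\circ)$ is $$I=\{\xi_\alpha : \alpha\in B_n\}\cup\{(k,k;\mathrm{id}) : k\in[n]\}\cup\{{}^{(i,j)}\zeta_{(i,j)} : i,j\in[n]\}.$$ Hence $|I|=2n^2+n+1$.
   Context: For $n\ge 1$ let $[n]=\{1,\dots,n\}$. The Brandt semigroup $(B_n,+)$ has underlying set $B_n=([n]\times[n])\cup\{\vartheta\}$ with $(i,j)+(k,l)=(i,l)$ if $j=k$, $(i,j)+(k,l)=\vartheta$ if $j\ne k$, and $\alpha+\vartheta=\vartheta+\alpha=\vartheta$ for all $\alpha\in B_n$. $M(B_n)$ is the set of all maps $B_n\to B_n$; arguments are written on the left of functions. It carries pointwise addition $\alpha(f+g)=\alpha f+\alpha g$ and composition $\alpha(f\circ g)=(\alpha f)g$. An affine map over $B_n$ is a map of the form $g+h$ with $g$ an endomorphism of the semigroup $(B_n,+)$ (not required to fix $\vartheta$) and $h\in M(B_n)$ a constant map. $A^+(B_n)$ (the affine near-semiring over $B_n$) is the smallest subset of $M(B_n)$ that contains all affine maps and is closed under $+$ and $\circ$. Notation for maps on $B_n$: $\xi_\alpha$ is the constant map with value $\alpha$; for $k,q\in[n]$ and a permutation $\sigma$ of $[n]$, $(k,q;\sigma)$ is the map with $(i,k)\mapsto(i\sigma,q)$ for all $i\in[n]$ and every other element of $B_n$ sent to $\vartheta$; $\mathrm{id}$ is the identity permutation of $[n]$; for $k,l,p,q\in[n]$, ${}^{(k,l)}\zeta_{(p,q)}$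 is the map sending $(k,l)$ to $(p,q)$ and every other element of $B_n$ to $\vartheta$. *)

theory Defs
  imports Main "HOL-Library.FuncSet"
begin

datatype brandt = Pair_el nat nat | Zero_el

definition brandt_carrier :: "nat \<Rightarrow> brandt set" where
  "brandt_carrier n = {Pair_el i j | i j. i \<in> {1..n} \<and> j \<in> {1..n}} \<union> {Zero_el}"

fun brandt_add :: "brandt \<Rightarrow> brandt \<Rightarrow> brandt" where
  "brandt_add (Pair_el i j) (Pair_el k l) = (if j = k then Pair_el i l else Zero_el)"
| "brandt_add x Zero_el = Zero_el"
| "brandt_add Zero_el x = Zero_el"

text \<open>Maps on the carrier are extensional functions (\<^term>\<open>undefined\<close> off the carrier), so
  that equality of HOL functions is equality of maps and cardinalities are meaningful.\<close>

definition brandt_maps :: "nat \<Rightarrow> (brandt \<Rightarrow> brandt) set" where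
  "brandt_maps n = brandt_carrier n \<rightarrow>\<^sub>E brandt_carrier n"

definition brandt_map_add :: "nat \<Rightarrow> (brandt \<Rightarrow> brandt) \<Rightarrow> (brandt \<Rightarrow> brandt) \<Rightarrow> brandt \<Rightarrow> brandt" where
  "brandt_map_add n f g = (\<lambda>x\<in>brandt_carrier n. brandt_add (f x) (g x))"

text \<open>Arguments are written on the left of maps, so the product of \<open>f\<close> and \<open>g\<close> applies \<open>f\<close> first.\<close>

definition brandt_map_comp :: "nat \<Rightarrow> (brandt \<Rightarrow> brandt) \<Rightarrow> (brandt \<Rightarrow> brandt) \<Rightarrow> brandt \<Rightarrow> brandt" where
  "brandt_map_comp n f g = compose (brandt_carrier n) g f"

definition brandt_End :: "nat \<Rightarrow> (brandt \<Rightarrow> brandt) set" where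
  "brandt_End n = {g \<in> brandt_maps n. \<forall>x\<in>brandt_carrier n. \<forall>y\<in>brandt_carrier n.
     g (brandt_add x y) = brandt_add (g x) (g y)}"

definition const_map :: "nat \<Rightarrow> brandt \<Rightarrow> brandt \<Rightarrow> brandt" where
  "const_map n a = (\<lambda>x\<in>brandt_carrier n. a)"

definition affine_maps :: "nat \<Rightarrow> (brandt \<Rightarrow> brandt) set" where
  "affine_maps n = {brandt_map_add n g (const_map n a) | g a. g \<in> brandt_End n \<and> a \<in> brandt_carrier n}"

inductive_set affine_near_semiring :: "nat \<Rightarrow> (brandt \<Rightarrow> brandt) set" for n :: nat where
  affine: "f \<in> affine_maps n \<Longrightarrow> f \<in> affine_near_semiring n"
| add: "f \<in> affine_near_semiring n \<Longrightarrow> g \<in> affine_near_semiring n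
    \<Longrightarrow> brandt_map_add n f g \<in> affine_near_semiring n"
| comp: "f \<in> affine_near_semiring n \<Longrightarrow> g \<in> affine_near_semiring n
    \<Longrightarrow> brandt_map_comp n f g \<in> affine_near_semiring n"

definition idempotents :: "'a set \<Rightarrow> ('a \<Rightarrow> 'a \<Rightarrow> 'a) \<Rightarrow> 'a set" where
  "idempotents S mult = {e \<in> S. mult e e = e}"

text \<open>The map \<open>(k, q; \<sigma>)\<close>, intended for permutations \<open>\<sigma>\<close> of \<open>{1..n}\<close>.\<close>

definition perm_map :: "nat \<Rightarrow> nat \<Rightarrow> nat \<Rightarrow> (nat \<Rightarrow> nat) \<Rightarrow> brandt \<Rightarrow> brandt" where
  "perm_map n k q \<sigma> = (\<lambda>x\<in>brandt_carrier n.
     case x of Pair_el i j \<Rightarrow> if j = k then Pair_el (\<sigma> i) q else Zero_el | Zero_el \<Rightarrow> Zero_el)"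

text \<open>\<open>zeta_map n k l p q\<close> sends \<open>(k, l)\<close> to \<open>(p, q)\<close> and everything else to zero.\<close>

definition zeta_map :: "nat \<Rightarrow> nat \<Rightarrow> nat \<Rightarrow> nat \<Rightarrow> nat \<Rightarrow> brandt \<Rightarrow> brandt" where
  "zeta_map n k l p q = (\<lambda>x\<in>brandt_carrier n. if x = Pair_el k l then Pair_el p q else Zero_el)"

end

theory Submission
  imports Defs
begin

text \<open>
  An endomorphism of the Brandt semigroup is either constant or of the form
  \<open>(i, j) \<mapsto> (i\<sigma>, j\<sigma>)\<close>, \<open>\<vartheta> \<mapsto> \<vartheta>\<close> with \<open>\<sigma>\<close> injective.  So affine maps are constant or of the
  form \<open>(k, q; \<sigma>)\<close>, and the constant maps, the maps \<open>(k, q; \<sigma>)\<close> and the maps which vanish off a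
  single pair together form a set closed under sum and composition.  The idempotents can be read off
  from this set, and each of them is easily generated by affine maps.
\<close>

section \<open>Carrier, closure and evaluation rules\<close>

lemma Zero_el_carrier [simp]: "Zero_el \<in> brandt_carrier n"
  by (simp add: brandt_carrier_def)

lemma Pair_el_carrier [simp]: "Pair_el i j \<in> brandt_carrier n \<longleftrightarrow> i \<in> {1..n} \<and> j \<in> {1..n}"
  by (auto simp: brandt_carrier_def)

lemma brandt_add_Zero [simp]: "brandt_add Zero_el x = Zero_el" "brandt_add x Zero_el = Zero_el"
  by (cases x; simp)+

lemma brandt_add_closed:
  "x \<in> brandt_carrier n \<Longrightarrow> y \<in> brandt_carrier n \<Longrightarrow> brandt_add x y \<in> brandt_carrier n"
  by (cases x; cases y) auto

lemma brandt_maps_closed: "f \<in> brandt_maps n \<Longrightarrow> x \<in> brandt_carrier n \<Longrightarrow> f x \<in> brandt_carrier n"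
  by (auto simp: brandt_maps_def)

lemma brandt_maps_eqI:
  assumes "f \<in> brandt_maps n" "g \<in> brandt_maps n" "\<And>x. x \<in> brandt_carrier n \<Longrightarrow> f x = g x"
  shows "f = g"
  using assms unfolding brandt_maps_def by (rule PiE_ext)

lemma brandt_map_add_apply [simp]:
  "x \<in> brandt_carrier n \<Longrightarrow> brandt_map_add n f g x = brandt_add (f x) (g x)"
  by (simp add: brandt_map_add_def)

lemma brandt_map_comp_apply [simp]:
  "x \<in> brandt_carrier n \<Longrightarrow> brandt_map_comp n f g x = g (f x)"
  by (simp add: brandt_map_comp_def compose_def)

lemma const_map_apply [simp]: "x \<in> brandt_carrier n \<Longrightarrow> const_map n a x = a"
  by (simp add: const_map_def)

lemma zeta_map_apply [simp]:
  "x \<in> brandt_carrier n \<Longrightarrow> zeta_map n k l p q x = (if x = Pair_el k l then Pair_el p q else Zero_el)"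
  by (simp add: zeta_map_def)

lemma perm_map_Pair [simp]:
  "i \<in> {1..n} \<Longrightarrow> j \<in> {1..n} \<Longrightarrow>
     perm_map n k q \<sigma> (Pair_el i j) = (if j = k then Pair_el (\<sigma> i) q else Zero_el)"
  by (simp add: perm_map_def)

lemma perm_map_Zero [simp]: "perm_map n k q \<sigma> Zero_el = Zero_el"
  by (simp add: perm_map_def)

lemma brandt_map_add_maps [simp]:
  "f \<in> brandt_maps n \<Longrightarrow> g \<in> brandt_maps n \<Longrightarrow> brandt_map_add n f g \<in> brandt_maps n"
  by (auto simp: brandt_maps_def brandt_map_add_def intro!: brandt_add_closed)

lemma brandt_map_comp_maps [simp]:
  "f \<in> brandt_maps n \<Longrightarrow> g \<in> brandt_maps n \<Longrightarrow> brandt_map_comp n f g \<in> brandt_maps n"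
  by (auto simp: brandt_maps_def brandt_map_comp_def compose_def)

lemma const_map_maps [simp]: "const_map n a \<in> brandt_maps n \<longleftrightarrow> a \<in> brandt_carrier n"
  using Zero_el_carrier[of n]
  by (auto simp: brandt_maps_def const_map_def PiE_iff simp del: Zero_el_carrier)

lemma zeta_map_maps [simp]:
  "p \<in> {1..n} \<Longrightarrow> q \<in> {1..n} \<Longrightarrow> zeta_map n k l p q \<in> brandt_maps n"
  by (auto simp: brandt_maps_def zeta_map_def)

lemma perm_map_maps [simp]:
  assumes "q \<in> {1..n}" "\<sigma> \<in> {1..n} \<rightarrow> {1..n}"
  shows "perm_map n k q \<sigma> \<in> brandt_maps n"
  using assms by (auto simp: brandt_maps_def perm_map_def Pi_iff split: brandt.splits)

section \<open>Endomorphisms of the Brandt semigroup\<close>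

text \<open>Since \<vartheta> absorbs, so does its image on the range of \<open>g\<close>: adding
  \<open>g x\<close> to \<open>g Zero_el\<close> on either side gives \<open>g Zero_el\<close> back.
  A nonzero pair absorbs in this way only itself.\<close>

lemma brandt_End_constant:
  assumes g: "g \<in> brandt_End n" and nz: "g Zero_el \<noteq> Zero_el"
  shows "g = const_map n (g Zero_el)"
proof (rule brandt_maps_eqI)
  show "g \<in> brandt_maps n" using g by (simp add: brandt_End_def)
  then show "const_map n (g Zero_el) \<in> brandt_maps n"
    using brandt_maps_closed by simp
  obtain a b where ab: "g Zero_el = Pair_el a b" using nz by (cases "g Zero_el") auto
  fix x assume x: "x \<in> brandt_carrier n"
  have "brandt_add (g x) (g Zero_el) = g Zero_el" "brandt_add (g Zero_el) (g x) = g Zero_el"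
    "brandt_add (g Zero_el) (g Zero_el) = g Zero_el"
    using g x unfolding brandt_End_def
    by (metis (mono_tags, lifting) Zero_el_carrier brandt_add_Zero mem_Collect_eq)+
  then show "g x = const_map n (g Zero_el) x"
    using x by (cases "g x") (simp_all add: ab split: if_splits)
qed

lemma brandt_End_cases:
  assumes g: "g \<in> brandt_End n"
  obtains a where "g = const_map n a" "a \<in> brandt_carrier n"
  | \<sigma> where "\<sigma> \<in> {1..n} \<rightarrow> {1..n}" "inj_on \<sigma> {1..n}" "g Zero_el = Zero_el"
      "\<And>i j. i \<in> {1..n} \<Longrightarrow> j \<in> {1..n} \<Longrightarrow> g (Pair_el i j) = Pair_el (\<sigma> i) (\<sigma> j)"
proof -
  have gm: "g \<in> brandt_maps n" using g by (simp add: brandt_End_def)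
  have hom: "g (brandt_add x y) = brandt_add (g x) (g y)"
    if "x \<in> brandt_carrier n" "y \<in> brandt_carrier n" for x y
    using g that by (simp add: brandt_End_def)
  consider "g Zero_el \<noteq> Zero_el"
    | "\<And>x. x \<in> brandt_carrier n \<Longrightarrow> g x = Zero_el"
    | i j where "g Zero_el = Zero_el" "i \<in> {1..n}" "j \<in> {1..n}" "g (Pair_el i j) \<noteq> Zero_el"
    by (metis Pair_el_carrier brandt.exhaust)
  then show thesis
  proof cases
    case 1
    then show ?thesis
      using brandt_End_constant[OF g] brandt_maps_closed[OF gm Zero_el_carrier] that(1) by blast
  next
    case 2
    then have "g = const_map n Zero_el"
      by (intro brandt_maps_eqI[OF gm]) simp_all
    then show ?thesis using that(1) by simp
  next
    case (3 i0 j0)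
    \<comment> \<open>One surviving pair forces all to survive, because every pair is a factor of
      it: (i0, j0) = (i0, k) + (k, l) + (l, j0).\<close>
    have nz: "g (Pair_el k l) \<noteq> Zero_el" if "k \<in> {1..n}" "l \<in> {1..n}" for k l
    proof
      assume z: "g (Pair_el k l) = Zero_el"
      have "g (Pair_el i0 j0)
          = brandt_add (brandt_add (g (Pair_el i0 k)) (g (Pair_el k l))) (g (Pair_el l j0))"
        using hom[of "Pair_el i0 k" "Pair_el k l"] hom[of "Pair_el i0 l" "Pair_el l j0"] 3 that
        by simp
      with z 3 show False by simp
    qed
    \<comment> \<open>Homomorphisms preserve idempotents, and the nonzero idempotents are the
      diagonal pairs. The diagonal therefore determines \<sigma>.\<close>
    have "\<exists>m. g (Pair_el k k) = Pair_el m m" if "k \<in> {1..n}" for k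
      using hom[of "Pair_el k k" "Pair_el k k"] nz[of k k] that
      by (cases "g (Pair_el k k)") (auto split: if_splits)
    then obtain \<sigma> where \<sigma>: "\<And>k. k \<in> {1..n} \<Longrightarrow> g (Pair_el k k) = Pair_el (\<sigma> k) (\<sigma> k)"
      by metis
    show ?thesis
    proof (rule that(2))
      show "\<sigma> \<in> {1..n} \<rightarrow> {1..n}"
      proof
        fix k assume "k \<in> {1..n}"
        then show "\<sigma> k \<in> {1..n}"
          using brandt_maps_closed[OF gm, of "Pair_el k k"] \<sigma>[of k] by simp
      qed
      show "inj_on \<sigma> {1..n}"
      proof (rule inj_onI, rule ccontr)
        fix k l assume kl: "k \<in> {1..n}" "l \<in> {1..n}" "\<sigma> k = \<sigma> l" "k \<noteq> l"
        \<comment> \<open>For distinct k and l the sum (k, k) + (l, l) is \<vartheta>, which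
          \<open>g\<close> fixes; equal values of \<sigma> would make the sum of the images a
          nonzero pair.\<close>
        then show False
          using hom[of "Pair_el k k" "Pair_el l l"] 3(1) by (simp add: \<sigma> del: atLeastAtMost_iff)
      qed
      show "g Zero_el = Zero_el" by fact
      fix i j assume ij: "i \<in> {1..n}" "j \<in> {1..n}"
      obtain a b where ab: "g (Pair_el i j) = Pair_el a b"
        using nz[OF ij] by (cases "g (Pair_el i j)") auto
      \<comment> \<open>The diagonal pairs (i, i) and (j, j) are left and right identities for (i,
        j); their images pin down both coordinates of its image.\<close>
      have "brandt_add (g (Pair_el i i)) (g (Pair_el i j)) = g (Pair_el i j)"
        "brandt_add (g (Pair_el i j)) (g (Pair_el j j)) = g (Pair_el i j)"
        using hom[of "Pair_el i i" "Pair_el i j"] hom[of "Pair_el i j" "Pair_el j j"] ij by simp_all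
      then show "g (Pair_el i j) = Pair_el (\<sigma> i) (\<sigma> j)"
        using ij by (simp add: \<sigma> ab del: atLeastAtMost_iff split: if_splits)
    qed
  qed
qed

section \<open>Constant, permutation and one-point maps; location of the affine maps\<close>

definition const_maps :: "nat \<Rightarrow> (brandt \<Rightarrow> brandt) set" where
  "const_maps n = const_map n ` brandt_carrier n"

text \<open>An injective self-map of the finite set \<open>{1..n}\<close> is a permutation of it,
  and \<open>perm_map\<close> ignores the values of \<sigma> elsewhere, so these are exactly the
  maps (k, q; \<sigma>).\<close>

definition perm_maps :: "nat \<Rightarrow> (brandt \<Rightarrow> brandt) set" where
  "perm_maps n = {perm_map n k q \<sigma> | k q \<sigma>.
     k \<in> {1..n} \<and> q \<in> {1..n} \<and> \<sigma> \<in> {1..n} \<rightarrow> {1..n} \<and> inj_on \<sigma> {1..n}}"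

text \<open>The value at the distinguished pair may itself be \<vartheta>. Closure proofs then only
  have to bound the support, without deciding whether it is empty.\<close>

definition point_maps :: "nat \<Rightarrow> (brandt \<Rightarrow> brandt) set" where
  "point_maps n = {f \<in> brandt_maps n. \<exists>k\<in>{1..n}. \<exists>l\<in>{1..n}.
     \<forall>x\<in>brandt_carrier n. x \<noteq> Pair_el k l \<longrightarrow> f x = Zero_el}"

lemma const_mapsI [intro]: "a \<in> brandt_carrier n \<Longrightarrow> const_map n a \<in> const_maps n"
  by (simp add: const_maps_def)

lemma const_mapsI':
  "f \<in> brandt_maps n \<Longrightarrow> a \<in> brandt_carrier n \<Longrightarrow> (\<And>x. x \<in> brandt_carrier n \<Longrightarrow> f x = a)
     \<Longrightarrow> f \<in> const_maps n"
  using brandt_maps_eqI[of f n "const_map n a"] by auto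

lemma const_maps_maps: "const_maps n \<subseteq> brandt_maps n"
  by (auto simp: const_maps_def)

lemma perm_maps_maps: "perm_maps n \<subseteq> brandt_maps n"
  by (auto simp: perm_maps_def)

lemma point_maps_maps: "point_maps n \<subseteq> brandt_maps n"
  by (auto simp: point_maps_def)

text \<open>All nonzero values of (k, q; \<sigma>) have second coordinate q, so a constant (p, r)
  added on the right either replaces that coordinate everywhere or annihilates the map.\<close>

lemma perm_map_add_const:
  assumes "q \<in> {1..n}" "\<sigma> \<in> {1..n} \<rightarrow> {1..n}" "p \<in> {1..n}" "r \<in> {1..n}"
  shows "brandt_map_add n (perm_map n k q \<sigma>) (const_map n (Pair_el p r))
    = (if q = p then perm_map n k r \<sigma> else const_map n Zero_el)"
proof (rule brandt_maps_eqI)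
  fix x assume "x \<in> brandt_carrier n"
  then show "brandt_map_add n (perm_map n k q \<sigma>) (const_map n (Pair_el p r)) x
    = (if q = p then perm_map n k r \<sigma> else const_map n Zero_el) x"
    by (cases x) auto
qed (use assms in auto)

text \<open>For a nonconstant endomorphism, (\<sigma> i, \<sigma> j) + (p, q) is nonzero only if
  \<sigma> j = p. Injectivity allows at most one such j, which becomes the index k of (k, q;
  \<sigma>).\<close>

lemma affine_maps_subset: "affine_maps n \<subseteq> const_maps n \<union> perm_maps n"
proof
  fix f assume "f \<in> affine_maps n"
  then obtain g a where f: "f = brandt_map_add n g (const_map n a)"
    and g: "g \<in> brandt_End n" and a: "a \<in> brandt_carrier n"
    by (auto simp: affine_maps_def)
  from g have fm: "f \<in> brandt_maps n" using a by (simp add: f brandt_End_def)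
  from g show "f \<in> const_maps n \<union> perm_maps n"
  proof (cases rule: brandt_End_cases)
    case (1 b)
    then show ?thesis
      using brandt_add_closed[of b n a] a const_mapsI'[OF fm, of "brandt_add b a"] by (simp add: f)
  next
    case (2 \<sigma>)
    show ?thesis
    proof (cases a)
      case Zero_el
      then have "f \<in> const_maps n" by (intro const_mapsI'[OF fm, of Zero_el]) (simp_all add: f)
      then show ?thesis ..
    next
      case (Pair_el p q)
      show ?thesis
      proof (cases "\<exists>k\<in>{1..n}. \<sigma> k = p")
        case False
        have "f x = Zero_el" if "x \<in> brandt_carrier n" for x
          using that False 2 by (cases x) (auto simp: f Pair_el)
        then show ?thesis by (auto intro!: const_mapsI'[of _ n Zero_el] fm)
      next
        case True
        then obtain k where k: "k \<in> {1..n}" "\<sigma> k = p" by blast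
        have "f = perm_map n k q \<sigma>"
        proof (rule brandt_maps_eqI[OF fm])
          show "perm_map n k q \<sigma> \<in> brandt_maps n" using 2 a Pair_el by simp
          fix x assume x: "x \<in> brandt_carrier n"
          then show "f x = perm_map n k q \<sigma> x"
            using 2(1,3,4) inj_onD[OF 2(2)] k by (cases x) (auto simp: f Pair_el)
        qed
        then show ?thesis using 2 k a Pair_el by (auto simp: perm_maps_def)
      qed
    qed
  qed
qed

section \<open>Closure under sums\<close>

lemma point_mapsI:
  assumes "f \<in> brandt_maps n" "k \<in> {1..n}" "l \<in> {1..n}"
    "\<And>x. x \<in> brandt_carrier n \<Longrightarrow> x \<noteq> Pair_el k l \<Longrightarrow> f x = Zero_el"
  shows "f \<in> point_maps n"
  using assms unfolding point_maps_def by blast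

text \<open>As \<vartheta> is absorbing, the support of a sum lies in the support of each
  summand.\<close>

lemma brandt_map_add_point:
  assumes "f \<in> brandt_maps n" "g \<in> brandt_maps n" "f \<in> point_maps n \<or> g \<in> point_maps n"
  shows "brandt_map_add n f g \<in> point_maps n"
  using assms by (fastforce simp: point_maps_def)

text \<open>The second coordinate of the constant must match \<sigma> i, which fixes i by
  injectivity, while the second coordinate of the argument must be k. Hence at most one pair
  survives.\<close>

lemma const_map_add_perm:
  assumes f: "f \<in> const_maps n" and g: "g \<in> perm_maps n"
  shows "brandt_map_add n f g \<in> const_maps n \<union> point_maps n"
proof -
  have m: "brandt_map_add n f g \<in> brandt_maps n"
    using f g const_maps_maps perm_maps_maps by (intro brandt_map_add_maps) auto
  obtain a k q \<sigma> where a: "f = const_map n a" "a \<in> brandt_carrier n"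
    and g: "g = perm_map n k q \<sigma>" "k \<in> {1..n}" "inj_on \<sigma> {1..n}"
    using f g by (auto simp: const_maps_def perm_maps_def)
  show ?thesis
  proof (cases "\<exists>i\<in>{1..n}. \<exists>p. a = Pair_el p (\<sigma> i)")
    case False
    have "brandt_map_add n f g x = Zero_el" if "x \<in> brandt_carrier n" for x
      using that False a by (cases x; cases a) (auto simp: g(1))
    then show ?thesis using const_mapsI'[OF m Zero_el_carrier] by blast
  next
    case True
    then obtain i p where i: "i \<in> {1..n}" "a = Pair_el p (\<sigma> i)" by blast
    have "brandt_map_add n f g x = Zero_el" if "x \<in> brandt_carrier n" "x \<noteq> Pair_el i k" for x
      using that i a inj_onD[OF g(3)] by (cases x) (auto simp: g(1))
    then show ?thesis using point_mapsI[OF m i(1) g(2)] by blast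
  qed
qed

text \<open>Nonzero values of \<open>f\<close> end in q, so a surviving argument (i, l) has \<tau> i
  = q, and injectivity of \<tau> leaves one candidate. If k and l differ the sum vanishes
  altogether, which \<open>point_maps\<close> permits.\<close>

lemma perm_map_add_perm:
  assumes f: "f \<in> perm_maps n" and g: "g \<in> perm_maps n"
  shows "brandt_map_add n f g \<in> const_maps n \<union> point_maps n"
proof -
  have m: "brandt_map_add n f g \<in> brandt_maps n"
    using f g perm_maps_maps by (intro brandt_map_add_maps) auto
  obtain k q \<sigma> l r \<tau> where f: "f = perm_map n k q \<sigma>"
    and g: "g = perm_map n l r \<tau>" "l \<in> {1..n}" "inj_on \<tau> {1..n}"
    using f g by (auto simp: perm_maps_def)
  show ?thesis
  proof (cases "\<exists>i\<in>{1..n}. \<tau> i = q")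
    case False
    have "brandt_map_add n f g x = Zero_el" if "x \<in> brandt_carrier n" for x
      using that False by (cases x) (auto simp: g(1) f)
    then show ?thesis using const_mapsI'[OF m Zero_el_carrier] by blast
  next
    case True
    then obtain i where i: "i \<in> {1..n}" "\<tau> i = q" by blast
    have "brandt_map_add n f g x = Zero_el" if "x \<in> brandt_carrier n" "x \<noteq> Pair_el i l" for x
      using that i inj_onD[OF g(3)] by (cases x) (auto simp: g(1) f)
    then show ?thesis using point_mapsI[OF m i(1) g(2)] by blast
  qed
qed

lemma perm_map_add_const_closed:
  assumes f: "f \<in> perm_maps n" and g: "g \<in> const_maps n"
  shows "brandt_map_add n f g \<in> const_maps n \<union> perm_maps n"
proof -
  have m: "brandt_map_add n f g \<in> brandt_maps n"
    using f g const_maps_maps perm_maps_maps by (intro brandt_map_add_maps) auto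
  obtain a where a: "g = const_map n a" "a \<in> brandt_carrier n"
    using g by (auto simp: const_maps_def)
  show ?thesis
  proof (cases a)
    case Zero_el
    then show ?thesis using m a by (auto intro!: const_mapsI'[of _ n Zero_el])
  next
    case (Pair_el p r)
    then show ?thesis using f a
      by (fastforce simp: perm_maps_def perm_map_add_const simp del: atLeastAtMost_iff)
  qed
qed

lemma brandt_map_add_closed:
  assumes "f \<in> const_maps n \<union> perm_maps n \<union> point_maps n"
    and "g \<in> const_maps n \<union> perm_maps n \<union> point_maps n"
  shows "brandt_map_add n f g \<in> const_maps n \<union> perm_maps n \<union> point_maps n"
proof -
  have fg: "f \<in> brandt_maps n" "g \<in> brandt_maps n"
    using assms const_maps_maps perm_maps_maps point_maps_maps by blast+
  \<comment> \<open>A one-point summand settles the matter whatever the other one is; four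
    combinations of constants and permutation maps remain.\<close>
  consider "f \<in> point_maps n \<or> g \<in> point_maps n" | "f \<in> const_maps n" "g \<in> const_maps n"
    | "f \<in> const_maps n" "g \<in> perm_maps n" | "f \<in> perm_maps n" "g \<in> const_maps n"
    | "f \<in> perm_maps n" "g \<in> perm_maps n"
    using assms by blast
  then show ?thesis
  proof cases
    case 1
    then show ?thesis using brandt_map_add_point[OF fg] by blast
  next
    case 2
    then obtain a b where "f = const_map n a" "a \<in> brandt_carrier n"
      "g = const_map n b" "b \<in> brandt_carrier n"
      by (auto simp: const_maps_def)
    then have "brandt_map_add n f g \<in> const_maps n"
      using brandt_add_closed[of a n b] brandt_map_add_maps[OF fg]
      by (intro const_mapsI'[of _ n "brandt_add a b"]) auto
    then show ?thesis by blast
  qed (use const_map_add_perm perm_map_add_perm perm_map_add_const_closed in blast)+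
qed

section \<open>Closure under composition\<close>

lemma perm_map_comp_perm:
  assumes f: "f \<in> perm_maps n" and g: "g \<in> perm_maps n"
  shows "brandt_map_comp n f g \<in> const_maps n \<union> perm_maps n"
proof -
  have m: "brandt_map_comp n f g \<in> brandt_maps n"
    using f g perm_maps_maps by (intro brandt_map_comp_maps) auto
  obtain k q \<sigma> l r \<tau> where f: "f = perm_map n k q \<sigma>" "k \<in> {1..n}" "q \<in> {1..n}"
      "\<sigma> \<in> {1..n} \<rightarrow> {1..n}" "inj_on \<sigma> {1..n}"
    and g: "g = perm_map n l r \<tau>" "r \<in> {1..n}" "\<tau> \<in> {1..n} \<rightarrow> {1..n}" "inj_on \<tau> {1..n}"
    using f g by (auto simp: perm_maps_def simp del: atLeastAtMost_iff)
  have \<sigma>: "\<sigma> i \<in> {1..n}" if "i \<in> {1..n}" for i using that f(4) by blast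
  show ?thesis
  proof (cases "q = l")
    case False
    have "brandt_map_comp n f g x = Zero_el" if "x \<in> brandt_carrier n" for x
      using that False \<sigma> f(3) by (cases x) (simp_all add: g(1) f(1) del: atLeastAtMost_iff)
    then show ?thesis using const_mapsI'[OF m Zero_el_carrier] by blast
  next
    case True
    \<comment> \<open>\<open>f\<close> is applied first, so its permutation is the inner one: (i, k)
      goes to (\<sigma> i, q) and then to (\<tau> (\<sigma> i), r).\<close>
    have im: "\<tau> \<circ> \<sigma> \<in> {1..n} \<rightarrow> {1..n}" using f g by auto
    have "brandt_map_comp n f g = perm_map n k r (\<tau> \<circ> \<sigma>)"
    proof (rule brandt_maps_eqI[OF m])
      show "perm_map n k r (\<tau> \<circ> \<sigma>) \<in> brandt_maps n" using im g by simp
      fix x assume "x \<in> brandt_carrier n"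
      then show "brandt_map_comp n f g x = perm_map n k r (\<tau> \<circ> \<sigma>) x"
        using True \<sigma> f(3) by (cases x) (simp_all add: g(1) f(1) del: atLeastAtMost_iff)
    qed
    moreover have "inj_on (\<tau> \<circ> \<sigma>) {1..n}"
      using f(4,5) g(4) by (intro comp_inj_on inj_on_subset[OF g(4)]) auto
    ultimately show ?thesis using f(2) g(2) im unfolding perm_maps_def by blast
  qed
qed

text \<open>Since \<open>g\<close> fixes \<vartheta>, a one-point support of \<open>f\<close> is
  inherited by the composite. If instead \<open>f\<close> is (k, q; \<sigma>) and \<open>g\<close>
  lives on (r, l), then injectivity of \<sigma> gives (r, l) at most one preimage under
  \<open>f\<close>.\<close>

lemma brandt_map_comp_point:
  assumes f: "f \<in> perm_maps n \<union> point_maps n" and g: "g \<in> perm_maps n \<union> point_maps n"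
    and "f \<in> point_maps n \<or> g \<in> point_maps n"
  shows "brandt_map_comp n f g \<in> const_maps n \<union> point_maps n"
proof -
  have fm: "f \<in> brandt_maps n" and gm: "g \<in> brandt_maps n"
    using assms perm_maps_maps point_maps_maps by blast+
  note m = brandt_map_comp_maps[OF fm gm]
  have z: "g Zero_el = Zero_el"
    using g by (auto simp: perm_maps_def point_maps_def)
  show ?thesis
  proof (cases "f \<in> point_maps n")
    case True
    then obtain k l where "k \<in> {1..n}" "l \<in> {1..n}"
      "\<And>x. x \<in> brandt_carrier n \<Longrightarrow> x \<noteq> Pair_el k l \<Longrightarrow> f x = Zero_el"
      unfolding point_maps_def by blast
    then have "brandt_map_comp n f g \<in> point_maps n"
      using z by (intro point_mapsI[OF m, of k l]) auto
    then show ?thesis by blast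
  next
    case False
    then obtain k q \<sigma> where fk: "f = perm_map n k q \<sigma>" "k \<in> {1..n}" "inj_on \<sigma> {1..n}"
      using f by (auto simp: perm_maps_def)
    obtain r l where g0: "\<And>x. x \<in> brandt_carrier n \<Longrightarrow> x \<noteq> Pair_el r l \<Longrightarrow> g x = Zero_el"
      using False assms(3) unfolding point_maps_def by blast
    have step: "brandt_map_comp n f g x = Zero_el"
      if "x \<in> brandt_carrier n" "f x \<noteq> Pair_el r l" for x
      using that g0 brandt_maps_closed[OF fm] by simp
    show ?thesis
    proof (cases "\<exists>i\<in>{1..n}. \<sigma> i = r")
      case False
      have "f x \<noteq> Pair_el r l" if "x \<in> brandt_carrier n" for x
        using that False by (cases x) (auto simp: fk(1))
      then show ?thesis using step const_mapsI'[OF m Zero_el_carrier] by blast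
    next
      case True
      then obtain i where i: "i \<in> {1..n}" "\<sigma> i = r" by blast
      have "f x \<noteq> Pair_el r l" if "x \<in> brandt_carrier n" "x \<noteq> Pair_el i k" for x
        using that i inj_onD[OF fk(3)] by (cases x) (auto simp: fk(1))
      then show ?thesis using step point_mapsI[OF m i(1) fk(2)] by blast
    qed
  qed
qed

lemma brandt_map_comp_closed:
  assumes "f \<in> const_maps n \<union> perm_maps n \<union> point_maps n"
    and "g \<in> const_maps n \<union> perm_maps n \<union> point_maps n"
  shows "brandt_map_comp n f g \<in> const_maps n \<union> perm_maps n \<union> point_maps n"
proof -
  have fg: "f \<in> brandt_maps n" "g \<in> brandt_maps n"
    using assms const_maps_maps perm_maps_maps point_maps_maps by blast+
  note m = brandt_map_comp_maps[OF fg]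
  \<comment> \<open>Constants are split off first: they yield constants on either side, and all
    other maps considered fix \<vartheta>.\<close>
  consider a where "f = const_map n a" "a \<in> brandt_carrier n"
    | a where "g = const_map n a" "a \<in> brandt_carrier n"
    | "f \<in> perm_maps n" "g \<in> perm_maps n"
    | "f \<in> perm_maps n \<union> point_maps n" "g \<in> perm_maps n \<union> point_maps n"
        "f \<in> point_maps n \<or> g \<in> point_maps n"
    using assms unfolding const_maps_def by blast
  then show ?thesis
  proof cases
    case 1
    then have "brandt_map_comp n f g \<in> const_maps n"
      using brandt_maps_closed[OF fg(2)] by (intro const_mapsI'[OF m, of "g a"]) auto
    then show ?thesis by blast
  next
    case 2
    then have "brandt_map_comp n f g \<in> const_maps n"
      using brandt_maps_closed[OF fg(1)] by (intro const_mapsI'[OF m, of a]) auto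
    then show ?thesis by blast
  qed (use perm_map_comp_perm brandt_map_comp_point in blast)+
qed

text \<open>An upper bound is enough here: idempotents are sought in the larger set, and those found
  are generated one by one afterwards.\<close>

lemma affine_near_semiring_subset:
  "affine_near_semiring n \<subseteq> const_maps n \<union> perm_maps n \<union> point_maps n"
proof
  fix f assume "f \<in> affine_near_semiring n"
  then show "f \<in> const_maps n \<union> perm_maps n \<union> point_maps n"
  proof induction
    case (affine f)
    then show ?case using affine_maps_subset by blast
  qed (rule brandt_map_add_closed brandt_map_comp_closed; assumption)+
qed

section \<open>Generating the listed idempotents\<close>

lemma const_map_affine:
  assumes "a \<in> brandt_carrier n"
  shows "const_map n a \<in> affine_near_semiring n"
proof (rule affine_near_semiring.affine)
  \<comment> \<open>\<open>b\<close> is an idempotent left identity of \<open>a\<close>: idempotence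
    makes its constant map an endomorphism, and b + a = a then exhibits the constant
    \<open>a\<close> as affine.\<close>
  define b where "b = (case a of Zero_el \<Rightarrow> Zero_el | Pair_el i j \<Rightarrow> Pair_el i i)"
  have b: "b \<in> brandt_carrier n" "brandt_add b b = b" "brandt_add b a = a"
    using assms by (cases a; simp add: b_def)+
  have "const_map n b \<in> brandt_End n"
    using b by (simp add: brandt_End_def brandt_add_closed)
  moreover have "const_map n a = brandt_map_add n (const_map n b) (const_map n a)"
    using assms b by (intro brandt_maps_eqI[of _ n]) auto
  ultimately show "const_map n a \<in> affine_maps n"
    using assms unfolding affine_maps_def by blast
qed

lemma perm_map_id_affine:
  assumes "k \<in> {1..n}"
  shows "perm_map n k k id \<in> affine_near_semiring n"
proof (rule affine_near_semiring.affine)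
  \<comment> \<open>The identity endomorphism plus the constant (k, k) works, as (i, j) + (k, k) is
    (i, k) for j = k and \<vartheta> otherwise.\<close>
  define g where "g = (\<lambda>x\<in>brandt_carrier n. x)"
  have g: "g \<in> brandt_End n"
    by (auto simp: brandt_End_def brandt_maps_def g_def brandt_add_closed)
  have "perm_map n k k id = brandt_map_add n g (const_map n (Pair_el k k))"
  proof (rule brandt_maps_eqI)
    fix x assume "x \<in> brandt_carrier n"
    then show "perm_map n k k id x = brandt_map_add n g (const_map n (Pair_el k k)) x"
      by (cases x) (auto simp: g_def)
  qed (use assms g in \<open>auto simp: brandt_End_def\<close>)
  then show "perm_map n k k id \<in> affine_maps n"
    using assms g unfolding affine_maps_def by fastforce
qed

lemma zeta_map_affine:
  assumes "i \<in> {1..n}" "j \<in> {1..n}"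
  shows "zeta_map n i j i j \<in> affine_near_semiring n"
proof -
  \<comment> \<open>The right summand keeps the pairs ending in j; the constant (i, i) on the left
    then keeps those starting with i.\<close>
  have "zeta_map n i j i j = brandt_map_add n (const_map n (Pair_el i i)) (perm_map n j j id)"
  proof (rule brandt_maps_eqI)
    fix x assume "x \<in> brandt_carrier n"
    then show "zeta_map n i j i j x
        = brandt_map_add n (const_map n (Pair_el i i)) (perm_map n j j id) x"
      by (cases x) auto
  qed (use assms in auto)
  then show ?thesis
    using assms const_map_affine[of "Pair_el i i" n] perm_map_id_affine[of j n]
    by (simp add: affine_near_semiring.add)
qed

section \<open>Idempotents within each family\<close>

text \<open>The nonzero value (\<sigma> i, q) of \<open>f\<close> at (i, k) must be fixed by
  \<open>f\<close>. This forces q = k and \<sigma> (\<sigma> i) = \<sigma> i, and injectivity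
  cancels one \<sigma>.\<close>

lemma idempotent_perm_map:
  assumes f: "f \<in> perm_maps n" and idem: "brandt_map_comp n f f = f"
  shows "\<exists>k\<in>{1..n}. f = perm_map n k k id"
proof -
  obtain k q \<sigma> where fk: "f = perm_map n k q \<sigma>" "k \<in> {1..n}" "q \<in> {1..n}"
    "\<sigma> \<in> {1..n} \<rightarrow> {1..n}" "inj_on \<sigma> {1..n}"
    using f unfolding perm_maps_def by blast
  have \<sigma>: "\<sigma> i \<in> {1..n}" if "i \<in> {1..n}" for i using that fk(4) by blast
  have *: "q = k \<and> \<sigma> i = i" if "i \<in> {1..n}" for i
  proof -
    have "f (f (Pair_el i k)) = f (Pair_el i k)"
      using fun_cong[OF idem, of "Pair_el i k"] that fk(2) by simp
    then have "q = k" "\<sigma> (\<sigma> i) = \<sigma> i"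
      using that fk(2,3) \<sigma> by (simp_all add: fk(1) del: atLeastAtMost_iff split: if_splits)
    then show ?thesis using inj_onD[OF fk(5)] \<sigma> that by blast
  qed
  have "f = perm_map n k k id"
  proof (rule brandt_maps_eqI)
    show "f \<in> brandt_maps n" using f perm_maps_maps by blast
    fix x assume "x \<in> brandt_carrier n"
    then show "f x = perm_map n k k id x"
      using * fk(2,3) by (cases x) (simp_all add: fk(1) del: atLeastAtMost_iff)
  qed (use fk(2) in simp)
  then show ?thesis using fk(2) by blast
qed

text \<open>The single possibly nonzero value \<open>y\<close> is a fixed point of \<open>f\<close>,
  and a map supported on (k, l) can fix only \<vartheta> and (k, l).\<close>

lemma idempotent_point_map:
  assumes f: "f \<in> point_maps n" and idem: "brandt_map_comp n f f = f"
  shows "f = const_map n Zero_el \<or> (\<exists>i\<in>{1..n}. \<exists>j\<in>{1..n}. f = zeta_map n i j i j)"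
proof -
  have fm: "f \<in> brandt_maps n" using f point_maps_maps by blast
  obtain k l where kl: "k \<in> {1..n}" "l \<in> {1..n}"
    and z: "\<And>x. x \<in> brandt_carrier n \<Longrightarrow> x \<noteq> Pair_el k l \<Longrightarrow> f x = Zero_el"
    using f unfolding point_maps_def by blast
  define y where "y = f (Pair_el k l)"
  have y: "y \<in> brandt_carrier n" unfolding y_def using kl by (intro brandt_maps_closed[OF fm]) simp
  have fy: "f y = y"
    using fun_cong[OF idem, of "Pair_el k l"] kl by (simp add: y_def)
  show ?thesis
  proof (cases "y = Zero_el")
    case True
    then have "f = const_map n Zero_el"
      using z by (intro brandt_maps_eqI[OF fm]) (auto simp: y_def)
    then show ?thesis ..
  next
    case False
    then have "y = Pair_el k l" using z[OF y] fy by auto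
    then have "f = zeta_map n k l k l"
      using z kl by (intro brandt_maps_eqI[OF fm]) (auto simp: y_def)
    then show ?thesis using kl by blast
  qed
qed

lemma idempotents_affine_near_semiring:
  "idempotents (affine_near_semiring n) (brandt_map_comp n) =
     {const_map n a | a. a \<in> brandt_carrier n}
     \<union> {perm_map n k k id | k. k \<in> {1..n}}
     \<union> {zeta_map n i j i j | i j. i \<in> {1..n} \<and> j \<in> {1..n}}" (is "?L = ?R")
proof
  show "?L \<subseteq> ?R"
  proof
    fix f assume "f \<in> ?L"
    then have idem: "brandt_map_comp n f f = f"
      and "f \<in> const_maps n \<union> perm_maps n \<union> point_maps n"
      using affine_near_semiring_subset by (auto simp: idempotents_def)
    then consider "f \<in> const_maps n" | "f \<in> perm_maps n" | "f \<in> point_maps n" by blast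
    then show "f \<in> ?R"
    proof cases
      case 1
      then show ?thesis by (auto simp: const_maps_def)
    next
      case 2
      then show ?thesis using idempotent_perm_map[OF _ idem] by blast
    next
      case 3
      then show ?thesis using idempotent_point_map[OF _ idem] Zero_el_carrier by blast
    qed
  qed
  have "brandt_map_comp n (const_map n a) (const_map n a) = const_map n a"
    if "a \<in> brandt_carrier n" for a
    using that by (intro brandt_maps_eqI[of _ n]) auto
  moreover have "brandt_map_comp n (perm_map n k k id) (perm_map n k k id) = perm_map n k k id"
    if "k \<in> {1..n}" for k
  proof (rule brandt_maps_eqI)
    fix x assume "x \<in> brandt_carrier n"
    then show "brandt_map_comp n (perm_map n k k id) (perm_map n k k id) x = perm_map n k k id x"
      by (cases x) auto
  qed (use that in auto)
  moreover have "brandt_map_comp n (zeta_map n i j i j) (zeta_map n i j i j) = zeta_map n i j i j"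
    if "i \<in> {1..n}" "j \<in> {1..n}" for i j
    using that by (intro brandt_maps_eqI[of _ n]) auto
  ultimately show "?R \<subseteq> ?L"
    by (auto simp: idempotents_def const_map_affine perm_map_id_affine zeta_map_affine
        simp del: atLeastAtMost_iff)
qed

section \<open>Counting the idempotents\<close>

lemma card_brandt_carrier: "finite (brandt_carrier n)" "card (brandt_carrier n) = n\<^sup>2 + 1"
proof -
  have eq: "brandt_carrier n = insert Zero_el (case_prod Pair_el ` ({1..n} \<times> {1..n}))"
    by (auto simp: brandt_carrier_def)
  have "inj_on (case_prod Pair_el) ({1..n} \<times> {1..n})" by (auto simp: inj_on_def)
  moreover have "Zero_el \<notin> case_prod Pair_el ` ({1..n} \<times> {1..n})" by auto
  ultimately show "finite (brandt_carrier n)" "card (brandt_carrier n) = n\<^sup>2 + 1"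
    unfolding eq by (simp_all add: card_image power2_eq_square)
qed

text \<open>The three families are injectively parametrised and pairwise disjoint, so their sizes
  n^2 + 1, n and n^2 add up. For n = 1 the last two families would coincide.\<close>

lemma card_idempotent_maps:
  assumes "n \<ge> 2"
  shows "card ({const_map n a | a. a \<in> brandt_carrier n}
     \<union> {perm_map n k k id | k. k \<in> {1..n}}
     \<union> {zeta_map n i j i j | i j. i \<in> {1..n} \<and> j \<in> {1..n}}) = 2 * n ^ 2 + n + 1"
proof -
  let ?p = "\<lambda>k. perm_map n k k id" and ?z = "\<lambda>(i, j). zeta_map n i j i j"
  let ?C = "const_map n ` brandt_carrier n" and ?P = "?p ` {1..n}"
    and ?Z = "?z ` ({1..n} \<times> {1..n})"
  have eq: "{const_map n a | a. a \<in> brandt_carrier n} = ?C" "{?p k | k. k \<in> {1..n}} = ?P"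
    "{zeta_map n i j i j | i j. i \<in> {1..n} \<and> j \<in> {1..n}} = ?Z"
    by (fastforce simp del: atLeastAtMost_iff)+
  have injC: "inj_on (const_map n) (brandt_carrier n)"
    by (rule inj_onI) (metis Zero_el_carrier const_map_apply)
  have injP: "inj_on ?p {1..n}"
  proof (rule inj_onI)
    fix k l assume k: "k \<in> {1..n}" and "?p k = ?p l"
    then have "?p k (Pair_el k k) = ?p l (Pair_el k k)" by simp
    with k show "k = l" by (simp split: if_splits)
  qed
  have injZ: "inj_on ?z ({1..n} \<times> {1..n})"
  proof (rule inj_onI, clarify)
    fix i j k l
    assume ij: "i \<in> {1..n}" "j \<in> {1..n}" and "zeta_map n i j i j = zeta_map n k l k l"
    then have "zeta_map n i j i j (Pair_el i j) = zeta_map n k l k l (Pair_el i j)" by simp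
    with ij show "i = k \<and> j = l" by (simp split: if_splits)
  qed
  \<comment> \<open>A permutation map is zero at \<vartheta> but not at (k, k), so it is not
    constant; the zeta maps are separated from the constants likewise.\<close>
  have "const_map n a \<noteq> ?p k" if "k \<in> {1..n}" for a k
  proof
    assume "const_map n a = ?p k"
    from fun_cong[OF this, of "Pair_el k k"] fun_cong[OF this, of Zero_el] that
    show False by simp
  qed
  then have CP: "?C \<inter> ?P = {}" by auto
  have "const_map n a \<noteq> zeta_map n i j i j" if "i \<in> {1..n}" "j \<in> {1..n}" for a i j
  proof
    assume "const_map n a = zeta_map n i j i j"
    from fun_cong[OF this, of "Pair_el i j"] fun_cong[OF this, of Zero_el] that
    show False by simp
  qed
  then have CZ: "?C \<inter> ?Z = {}" by auto
  have "?p k \<noteq> zeta_map n i j i j" if "k \<in> {1..n}" for i j k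
  proof
    assume e: "?p k = zeta_map n i j i j"
    \<comment> \<open>This is where \<open>n \<ge> 2\<close> enters: the permutation map is nonzero
      at both (1, k) and (2, k), a zeta map at only one pair.\<close>
    from fun_cong[OF e, of "Pair_el 1 k"] fun_cong[OF e, of "Pair_el 2 k"] that assms
    show False by (auto split: if_splits)
  qed
  then have PZ: "?P \<inter> ?Z = {}" by auto
  have "card (?C \<union> ?P \<union> ?Z) = card ?C + card ?P + card ?Z"
    using CP CZ PZ card_brandt_carrier(1)[of n] by (simp add: card_Un_disjoint Int_Un_distrib2)
  also have "\<dots> = (n\<^sup>2 + 1) + n + n * n"
    unfolding card_image[OF injC] card_image[OF injP] card_image[OF injZ]
    by (simp add: card_brandt_carrier)
  finally show ?thesis unfolding eq by (simp add: power2_eq_square)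
qed

theorem theorem4p9:
  fixes n :: nat
  assumes "n \<ge> 2"
  shows "idempotents (affine_near_semiring n) (brandt_map_comp n) =
           {const_map n a | a. a \<in> brandt_carrier n}
           \<union> {perm_map n k k id | k. k \<in> {1..n}}
           \<union> {zeta_map n i j i j | i j. i \<in> {1..n} \<and> j \<in> {1..n}}
         \<and> card (idempotents (affine_near_semiring n) (brandt_map_comp n)) = 2 * n ^ 2 + n + 1"
  using card_idempotent_maps[OF assms] unfolding idempotents_affine_near_semiring by blast

end
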